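(* No TSI Polish group is unbalanced.
   Context: A Polish group is TSI if it admits a compatible two-sided invariant metric. For a Polish group $G$, let $c(G)\subseteq G^\omega$ be the group of all convergent sequences in $G$ (pointwise operations), topologized by the supremum metric $d_u(x,y)=\sup_n d(x(n),y(n))$ for a compatible complete metric $d$ on $G$; it is a Polish group acting continuously on $G^\omega$ by left multiplication $(\gamma x)(n)=\gamma(n)x(n)$, with orbits $[x]=c(G)x$. For a Polish group $K$ acting continuously on a Polish space $X$ and $x,y\in X$, write $x\leftrightsquigarrow y$ if for every open $V\ni 1_K$ and every open $U\subseteq X$ with $U\cap(Kx\cup Ky)\neq\emptyset$ there are $g^x,g^y\in K$ with $g^xx,g^yy\in U$, $g^yy\in\overline{V(g^xx)}$ and $g^xx\in\overline{V(g^yy)}$. $G$ is unbalanced if there exist $x,y\in G^\omega$ with $x\leftrightsquigarrow y$ (for the action of $c(G)$ on $G^\omega$) and $[x]\ne[y]$. *)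

theory Defs
  imports "HOL-Analysis.Analysis" "HOL-Algebra.Product_Groups" "HOL-Algebra.Group_Action"
begin

definition polish_topology :: "'a topology \<Rightarrow> bool"
  where "polish_topology X \<longleftrightarrow> completely_metrizable_space X \<and> separable_space X"

locale topological_group = group G for G (structure) +
  fixes T :: "'a topology"
  assumes topspace_eq: "topspace T = carrier G"
    and continuous_mult: "continuous_map (prod_topology T T) T (\<lambda>(x, y). x \<otimes> y)"
    and continuous_inv: "continuous_map T T (\<lambda>x. inv x)"

locale polish_group = topological_group +
  assumes polish: "polish_topology T"

definition compatible_metric :: "'a topology \<Rightarrow> ('a \<Rightarrow> 'a \<Rightarrow> real) \<Rightarrow> bool"
  where "compatible_metric T d \<longleftrightarrow>
    Metric_space (topspace T) d \<and> Metric_space.mtopology (topspace T) d = T"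

definition two_sided_invariant :: "('a, 'b) monoid_scheme \<Rightarrow> ('a \<Rightarrow> 'a \<Rightarrow> real) \<Rightarrow> bool"
  where "two_sided_invariant G d \<longleftrightarrow>
    (\<forall>g\<in>carrier G. \<forall>x\<in>carrier G. \<forall>y\<in>carrier G.
       d (g \<otimes>\<^bsub>G\<^esub> x) (g \<otimes>\<^bsub>G\<^esub> y) = d x y \<and> d (x \<otimes>\<^bsub>G\<^esub> g) (y \<otimes>\<^bsub>G\<^esub> g) = d x y)"

definition TSI :: "('a, 'b) monoid_scheme \<Rightarrow> 'a topology \<Rightarrow> bool"
  where "TSI G T \<longleftrightarrow> (\<exists>d. compatible_metric T d \<and> two_sided_invariant G d)"

definition compatible_complete_metric :: "'a topology \<Rightarrow> ('a \<Rightarrow> 'a \<Rightarrow> real) \<Rightarrow> bool"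
  where "compatible_complete_metric T d \<longleftrightarrow>
    compatible_metric T d \<and> Metric_space.mcomplete (topspace T) d"

abbreviation seq_group :: "('a, 'b) monoid_scheme \<Rightarrow> (nat \<Rightarrow> 'a) monoid"
  where "seq_group G \<equiv> product_group UNIV (\<lambda>_. G)"

abbreviation seq_topology :: "'a topology \<Rightarrow> (nat \<Rightarrow> 'a) topology"
  where "seq_topology T \<equiv> product_topology (\<lambda>_. T) UNIV"

definition conv_seq_group :: "('a, 'b) monoid_scheme \<Rightarrow> 'a topology \<Rightarrow> (nat \<Rightarrow> 'a) monoid"
  where "conv_seq_group G T = (seq_group G)
    \<lparr>carrier := {x \<in> carrier (seq_group G). \<exists>l. limitin T x l sequentially}\<rparr>"

text \<open>\<^const>\<open>Metric_space.fdist\<close> is the supremum distance on bounded functions and 0 elsewhere;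
  convergent sequences are bounded (see \<open>sup_dist_conv_seq\<close> below).\<close>

definition sup_dist :: "'a topology \<Rightarrow> ('a \<Rightarrow> 'a \<Rightarrow> real) \<Rightarrow> (nat \<Rightarrow> 'a) \<Rightarrow> (nat \<Rightarrow> 'a) \<Rightarrow> real"
  where "sup_dist T d = Metric_space.fdist (topspace T) d UNIV"

definition conv_seq_topology ::
    "('a, 'b) monoid_scheme \<Rightarrow> 'a topology \<Rightarrow> ('a \<Rightarrow> 'a \<Rightarrow> real) \<Rightarrow> (nat \<Rightarrow> 'a) topology"
  where "conv_seq_topology G T d =
    Metric_space.mtopology (carrier (conv_seq_group G T)) (sup_dist T d)"

text \<open>Restricted to the sequences in \<^term>\<open>G\<close>, because \<^const>\<open>group_action\<close>
  requires extensional functions.\<close>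

definition conv_seq_action ::
    "('a, 'b) monoid_scheme \<Rightarrow> (nat \<Rightarrow> 'a) \<Rightarrow> (nat \<Rightarrow> 'a) \<Rightarrow> (nat \<Rightarrow> 'a)"
  where "conv_seq_action G \<gamma> = (\<lambda>x \<in> carrier (seq_group G). \<lambda>n. \<gamma> n \<otimes>\<^bsub>G\<^esub> x n)"

text \<open>The relation usually written with a two-headed squiggly arrow, for a group \<^term>\<open>K\<close> with
  topology \<^term>\<open>S\<close> acting by \<^term>\<open>\<phi>\<close> on a space \<^term>\<open>X\<close>.\<close>

definition squig_related ::
    "('g, 'b) monoid_scheme \<Rightarrow> 'g topology \<Rightarrow> 'x topology \<Rightarrow> ('g \<Rightarrow> 'x \<Rightarrow> 'x) \<Rightarrow> 'x \<Rightarrow> 'x \<Rightarrow> bool"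
  where "squig_related K S X \<phi> x y \<longleftrightarrow>
    (\<forall>V U. openin S V \<and> \<one>\<^bsub>K\<^esub> \<in> V \<and> openin X U \<and> U \<inter> (orbit K \<phi> x \<union> orbit K \<phi> y) \<noteq> {} \<longrightarrow>
      (\<exists>gx\<in>carrier K. \<exists>gy\<in>carrier K. \<phi> gx x \<in> U \<and> \<phi> gy y \<in> U \<and>
         \<phi> gy y \<in> X closure_of ((\<lambda>v. \<phi> v (\<phi> gx x)) ` V) \<and>
         \<phi> gx x \<in> X closure_of ((\<lambda>v. \<phi> v (\<phi> gy y)) ` V)))"

text \<open>The choice of \<^term>\<open>d\<close> is immaterial, see \<open>conv_seq_topology_unique\<close> below.\<close>

definition unbalanced :: "('a, 'b) monoid_scheme \<Rightarrow> 'a topology \<Rightarrow> bool"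
  where "unbalanced G T \<longleftrightarrow>
    (\<exists>d. compatible_complete_metric T d \<and>
      (\<exists>x\<in>carrier (seq_group G). \<exists>y\<in>carrier (seq_group G).
         squig_related (conv_seq_group G T) (conv_seq_topology G T d) (seq_topology T)
           (conv_seq_action G) x y \<and>
         orbit (conv_seq_group G T) (conv_seq_action G) x \<noteq>
         orbit (conv_seq_group G T) (conv_seq_action G) y))"


context topological_group
begin

lemma conv_seq_carrier:
  "x \<in> carrier (conv_seq_group G T) \<longleftrightarrow>
    (\<forall>n. x n \<in> carrier G) \<and> (\<exists>l. limitin T x l sequentially)"
  by (auto simp: conv_seq_group_def PiE_UNIV_domain)

lemma conv_seq_bounded:
  assumes d: "compatible_metric T d" and x: "x \<in> carrier (conv_seq_group G T)"
  shows "x \<in> Metric_space.fspace (topspace T) d UNIV"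
proof -
  interpret M: Metric_space "topspace T" d
    using d by (simp add: compatible_metric_def)
  have T: "M.mtopology = T"
    using d by (simp add: compatible_metric_def)
  obtain l where l: "limitin T x l sequentially" and ran: "range x \<subseteq> topspace T"
    using x by (auto simp: conv_seq_carrier topspace_eq)
  have "compactin M.mtopology (insert l (range x))"
    using compactin_sequence_with_limit[OF l subset_refl ran] T by simp
  then have "M.mbounded (range x)"
    using M.compactin_imp_mbounded M.mbounded_insert by blast
  then show ?thesis
    using ran by (simp add: M.fspace_def)
qed

lemma sup_dist_conv_seq:
  assumes "compatible_metric T d"
    and "x \<in> carrier (conv_seq_group G T)" "y \<in> carrier (conv_seq_group G T)"
  shows "sup_dist T d x y = (SUP n. d (x n) (y n))"
    and "bdd_above (range (\<lambda>n. d (x n) (y n)))"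
proof -
  interpret M: Metric_space "topspace T" d
    using assms by (simp add: compatible_metric_def)
  show "sup_dist T d x y = (SUP n. d (x n) (y n))"
    using assms conv_seq_bounded by (simp add: sup_dist_def M.fdist_def)
  show "bdd_above (range (\<lambda>n. d (x n) (y n)))"
    using assms conv_seq_bounded by (intro M.bdd_above_dist) auto
qed

lemma Metric_space_sup_dist:
  assumes "compatible_metric T d"
  shows "Metric_space (carrier (conv_seq_group G T)) (sup_dist T d)"
proof -
  interpret M: Metric_space "topspace T" d
    using assms by (simp add: compatible_metric_def)
  show ?thesis
    unfolding sup_dist_def
    using Metric_space.subspace[OF M.Metric_space_funspace] conv_seq_bounded[OF assms] by blast
qed

lemma conv_seq_topology_le:
  assumes d1: "compatible_metric T d1" and d2: "compatible_metric T d2"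
    and U: "openin (conv_seq_topology G T d1) U"
  shows "openin (conv_seq_topology G T d2) U"
proof -
  let ?C = "carrier (conv_seq_group G T)"
  interpret M1: Metric_space "topspace T" d1 using d1 by (simp add: compatible_metric_def)
  interpret M2: Metric_space "topspace T" d2 using d2 by (simp add: compatible_metric_def)
  have T: "M1.mtopology = T" "M2.mtopology = T"
    using d1 d2 by (simp_all add: compatible_metric_def)
  interpret C1: Metric_space ?C "sup_dist T d1" by (rule Metric_space_sup_dist[OF d1])
  interpret C2: Metric_space ?C "sup_dist T d2" by (rule Metric_space_sup_dist[OF d2])
  have balls: "\<exists>\<delta>>0. M2.mball a \<delta> \<subseteq> M1.mball a \<epsilon>" if "a \<in> topspace T" "\<epsilon> > 0" for a \<epsilon>
  proof -
    have "openin M2.mtopology (M1.mball a \<epsilon>)"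
      using M1.openin_mball T by metis
    then show ?thesis
      using that by (simp add: M2.openin_mtopology)
  qed
  have UC: "U \<subseteq> ?C"
    using U by (simp add: conv_seq_topology_def C1.openin_mtopology)
  have "\<exists>\<delta>>0. C2.mball x \<delta> \<subseteq> U" if "x \<in> U" for x
  proof -
    obtain r where r: "r > 0" "C1.mball x r \<subseteq> U"
      using U \<open>x \<in> U\<close> by (auto simp: conv_seq_topology_def C1.openin_mtopology)
    have x: "x \<in> ?C" using UC that by blast
    have xn: "x n \<in> topspace T" for n using x by (simp add: conv_seq_carrier topspace_eq)
    obtain l where l: "limitin T x l sequentially" using x by (auto simp: conv_seq_carrier)
    have lT: "l \<in> topspace T" using l limitin_topspace by metis
    obtain e where e: "e > 0" "M2.mball l e \<subseteq> M1.mball l (r/4)"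
      using balls[OF lT, of "r/4"] r by auto
    obtain N where N: "\<And>n. n \<ge> N \<Longrightarrow> d2 (x n) l < e/2"
    proof -
      have "limitin M2.mtopology x l sequentially" using l T(2) by simp
      then have "\<forall>\<^sub>F n in sequentially. x n \<in> topspace T \<and> d2 (x n) l < e/2"
        using half_gt_zero[OF e(1)] unfolding M2.limitin_metric by blast
      then show ?thesis using that by (auto simp: eventually_sequentially)
    qed
    obtain f where f: "\<And>n. f n > 0" "\<And>n. M2.mball (x n) (f n) \<subseteq> M1.mball (x n) (r/2)"
    proof -
      have "\<forall>n. \<exists>\<delta>>0. M2.mball (x n) \<delta> \<subseteq> M1.mball (x n) (r/2)"
        using balls[OF xn half_gt_zero[OF r(1)]] by blast
      then have "\<exists>f. \<forall>n. f n > 0 \<and> M2.mball (x n) (f n) \<subseteq> M1.mball (x n) (r/2)"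
        by (rule choice)
      then show ?thesis using that by blast
    qed
    define \<delta> where "\<delta> = Min (insert (e/2) (f ` {..<N}))"
    have \<delta>: "\<delta> > 0" "\<delta> \<le> e/2" "\<And>n. n < N \<Longrightarrow> \<delta> \<le> f n"
    proof -
      show "\<delta> > 0" using e(1) f(1) by (auto simp: \<delta>_def)
      show "\<delta> \<le> e/2" unfolding \<delta>_def by (rule Min_le) auto
      show "\<delta> \<le> f n" if "n < N" for n unfolding \<delta>_def by (rule Min_le) (use that in auto)
    qed
    have close: "d1 (x n) z < r/2" if z: "z \<in> topspace T" "d2 (x n) z < \<delta>" for n z
    proof (cases "n < N")
      case True
      then have "z \<in> M2.mball (x n) (f n)" using z \<delta>(3)[of n] xn by auto
      then show ?thesis using f(2)[of n] by auto
    next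
      case False
      then have xl: "d2 (x n) l < e/2" using N by simp
      have lx: "d2 l (x n) < e/2" using xl M2.commute by metis
      have "d2 l z \<le> d2 l (x n) + d2 (x n) z" using M2.triangle lT xn z by blast
      then have "z \<in> M2.mball l e" "x n \<in> M2.mball l e"
        using lx z \<delta>(2) lT xn e(1) by auto
      then have "z \<in> M1.mball l (r/4)" "x n \<in> M1.mball l (r/4)" using e(2) by blast+
      then have "d1 l z < r/4" "d1 (x n) l < r/4" by (auto simp: M1.commute)
      moreover have "d1 (x n) z \<le> d1 (x n) l + d1 l z" using M1.triangle lT xn z by blast
      ultimately show ?thesis by simp
    qed
    have "C2.mball x \<delta> \<subseteq> C1.mball x r"
    proof
      fix y assume y: "y \<in> C2.mball x \<delta>"
      then have yC: "y \<in> ?C" and s: "(SUP n. d2 (x n) (y n)) < \<delta>"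
        using sup_dist_conv_seq(1)[OF d2 x] by auto
      have "d1 (x n) (y n) \<le> r/2" for n
      proof -
        have "d2 (x n) (y n) < \<delta>"
          using cSUP_upper[OF UNIV_I sup_dist_conv_seq(2)[OF d2 x yC], of n] s by linarith
        then show ?thesis
          using close[of "y n" n] yC by (simp add: conv_seq_carrier topspace_eq less_imp_le)
      qed
      then have "sup_dist T d1 x y \<le> r/2"
        unfolding sup_dist_conv_seq(1)[OF d1 x yC] by (intro cSUP_least) auto
      then show "y \<in> C1.mball x r"
        using x yC r(1) by simp
    qed
    then show ?thesis using r \<delta>(1) by blast
  qed
  then show ?thesis
    using UC by (simp add: conv_seq_topology_def C2.openin_mtopology)
qed

lemma conv_seq_topology_unique:
  assumes "compatible_metric T d1" "compatible_metric T d2"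
  shows "conv_seq_topology G T d1 = conv_seq_topology G T d2"
  unfolding topology_eq
  using conv_seq_topology_le[OF assms] conv_seq_topology_le[OF assms(2,1)] by blast

lemma subgroup_conv_seq: "subgroup (carrier (conv_seq_group G T)) (seq_group G)"
proof -
  interpret S: group "seq_group G" by (simp add: is_group)
  have lim_mult: "\<exists>l. limitin T (\<lambda>n. x n \<otimes> y n) l sequentially"
    if "limitin T x k sequentially" "limitin T y l sequentially" for x y k l
    using continuous_map_limit[OF continuous_mult, of "\<lambda>n. (x n, y n)" "(k, l)" sequentially] that
    by (auto simp: limitin_pairwise o_def)
  have lim_inv: "\<exists>l. limitin T (\<lambda>n. inv (x n)) l sequentially"
    if "limitin T x k sequentially" for x k
    using continuous_map_limit[OF continuous_inv that] by (auto simp: o_def)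
  show ?thesis
  proof (rule S.subgroupI)
    show "carrier (conv_seq_group G T) \<subseteq> carrier (seq_group G)"
      by (auto simp: conv_seq_group_def)
    have "(\<lambda>_. \<one>) \<in> carrier (conv_seq_group G T)"
      using topspace_eq by (auto simp: conv_seq_carrier limitin_const_iff intro!: exI[of _ \<one>])
    then show "carrier (conv_seq_group G T) \<noteq> {}" by blast
  next
    fix x assume x: "x \<in> carrier (conv_seq_group G T)"
    then have "x \<in> carrier (seq_group G)" by (simp add: conv_seq_group_def)
    then have "inv\<^bsub>seq_group G\<^esub> x = (\<lambda>n. inv (x n))"
      by (simp add: inv_product_group is_group restrict_UNIV)
    then show "inv\<^bsub>seq_group G\<^esub> x \<in> carrier (conv_seq_group G T)"
      using x lim_inv by (auto simp: conv_seq_carrier)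
  next
    fix x y assume "x \<in> carrier (conv_seq_group G T)" "y \<in> carrier (conv_seq_group G T)"
    then show "x \<otimes>\<^bsub>seq_group G\<^esub> y \<in> carrier (conv_seq_group G T)"
      using lim_mult by (auto simp: conv_seq_carrier restrict_UNIV)
  qed
qed

lemma group_conv_seq: "group (conv_seq_group G T)"
proof -
  interpret S: group "seq_group G" by (simp add: is_group)
  show ?thesis
    using S.subgroup_imp_group[OF subgroup_conv_seq] by (simp add: conv_seq_group_def)
qed

lemma group_action_conv_seq:
  "group_action (conv_seq_group G T) (carrier (seq_group G)) (conv_seq_action G)"
proof -
  interpret S: group "seq_group G" by (simp add: is_group)
  interpret C: group "conv_seq_group G T" by (rule group_conv_seq)
  have act: "conv_seq_action G g = (\<lambda>x\<in>carrier (seq_group G). g \<otimes>\<^bsub>seq_group G\<^esub> x)" for g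
    by (auto simp: conv_seq_action_def restrict_UNIV)
  have sub: "g \<in> carrier (seq_group G)" if "g \<in> carrier (conv_seq_group G T)" for g
    using that by (simp add: conv_seq_group_def)
  have bij: "bij_betw (conv_seq_action G g) (carrier (seq_group G)) (carrier (seq_group G))"
    if "g \<in> carrier (seq_group G)" for g
  proof -
    have "bij_betw (\<lambda>x. g \<otimes>\<^bsub>seq_group G\<^esub> x) (carrier (seq_group G)) (carrier (seq_group G))"
      using that S.inj_on_cmult S.surj_const_mult by (metis bij_betw_def)
    moreover have "conv_seq_action G g x = g \<otimes>\<^bsub>seq_group G\<^esub> x" if "x \<in> carrier (seq_group G)" for x
      using that by (simp only: act restrict_apply if_True)
    ultimately show ?thesis using bij_betw_cong by blast
  qed
  have "conv_seq_action G \<in> hom (conv_seq_group G T) (BijGroup (carrier (seq_group G)))"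
  proof (rule homI)
    fix g assume "g \<in> carrier (conv_seq_group G T)"
    then show "conv_seq_action G g \<in> carrier (BijGroup (carrier (seq_group G)))"
      using bij sub by (simp add: BijGroup_def Bij_def act)
  next
    fix g h
    assume gh: "g \<in> carrier (conv_seq_group G T)" "h \<in> carrier (conv_seq_group G T)"
    then have "conv_seq_action G g \<in> Bij (carrier (seq_group G))"
              "conv_seq_action G h \<in> Bij (carrier (seq_group G))"
      using bij sub by (simp_all add: Bij_def act)
    moreover have "g \<otimes>\<^bsub>conv_seq_group G T\<^esub> h = g \<otimes>\<^bsub>seq_group G\<^esub> h"
      by (simp add: conv_seq_group_def)
    moreover have "(g \<otimes>\<^bsub>seq_group G\<^esub> h) \<otimes>\<^bsub>seq_group G\<^esub> x
        = g \<otimes>\<^bsub>seq_group G\<^esub> (h \<otimes>\<^bsub>seq_group G\<^esub> x)"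
      "h \<otimes>\<^bsub>seq_group G\<^esub> x \<in> carrier (seq_group G)"
      if "x \<in> carrier (seq_group G)" for x
      using S.m_assoc[OF sub sub that] S.m_closed[OF sub that] gh by blast+
    ultimately show "conv_seq_action G (g \<otimes>\<^bsub>conv_seq_group G T\<^esub> h) =
        conv_seq_action G g \<otimes>\<^bsub>BijGroup (carrier (seq_group G))\<^esub> conv_seq_action G h"
      by (simp add: BijGroup_def act compose_def del: mult_product_group carrier_product_group
          cong: restrict_cong)
  qed
  then show ?thesis
    by (simp add: group_action_def group_hom_def group_hom_axioms_def C.is_group group_BijGroup)
qed

end

end

theory Submission
  imports Defs
begin

text \<open>A compatible two-sided invariant metric \<open>d\<close> on a Polish group is complete.  Given this, suppose
  \<open>x\<close> and \<open>y\<close> are related.  For each \<open>\<epsilon> > 0\<close>, take the \<open>\<epsilon>\<close>-ball about the identity as \<open>V\<close> and the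
  whole space as \<open>U\<close>: there are convergent sequences \<open>g\<close>, \<open>h\<close> with \<open>d (h n y n) (g n x n) \<le> \<epsilon>\<close> for all \<open>n\<close>,
  that is, by invariance, \<open>y x\<inverse>\<close> is uniformly \<open>\<epsilon>\<close>-close to the convergent sequence \<open>h\<inverse> g\<close>.  Hence
  \<open>y x\<inverse>\<close> is Cauchy, so it converges and carries \<open>x\<close> to \<open>y\<close>.\<close>

section \<open>Cauchy sequences and comparison of compatible metrics\<close>

text \<open>Telescoping against a geometric series; it supplies the \<rho>-Cauchy sequences of the
  completeness proof.\<close>

lemma (in Metric_space) MCauchy_of_geometric_steps:
  assumes M: "\<And>k. s k \<in> M" and step: "\<And>k. d (s k) (s (Suc k)) < (1/2) ^ k"
  shows "MCauchy s"
proof -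
  \<comment> \<open>The exact partial geometric sum; keeping the subtracted term lets the induction
    on \<open>j\<close> close.\<close>
  have bound: "d (s k) (s (k + j)) \<le> 2 * (1/2) ^ k - 2 * (1/2) ^ (k + j)" for k j
  proof (induction j)
    case 0
    show ?case using M by simp
  next
    case (Suc j)
    have "d (s k) (s (k + Suc j)) \<le> d (s k) (s (k + j)) + d (s (k + j)) (s (Suc (k + j)))"
      using triangle M by simp
    then show ?case
      using Suc.IH step[of "k + j"] by simp
  qed
  have from_N: "d (s N) (s n) \<le> 2 * (1/2) ^ N" if "N \<le> n" for N n
  proof -
    have "0 \<le> (1/2::real) ^ n" by simp
    moreover have "d (s N) (s n) \<le> 2 * (1/2) ^ N - 2 * (1/2) ^ n"
      using bound[of N "n - N"] that by simp
    ultimately show ?thesis by linarith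
  qed
  have "\<exists>N. \<forall>n n'. N \<le> n \<longrightarrow> N \<le> n' \<longrightarrow> d (s n) (s n') < \<epsilon>" if "\<epsilon> > 0" for \<epsilon>
  proof -
    obtain N where N: "(1/2::real) ^ N < \<epsilon> / 4"
      using real_arch_pow_inv[of "\<epsilon> / 4" "1/2"] \<open>\<epsilon> > 0\<close> by auto
    have "d (s n) (s n') < \<epsilon>" if "N \<le> n" "N \<le> n'" for n n'
    proof -
      have "d (s n) (s n') \<le> d (s N) (s n) + d (s N) (s n')"
        using triangle'' M by blast
      then show ?thesis
        using from_N[OF that(1)] from_N[OF that(2)] N by linarith
    qed
    then show ?thesis by blast
  qed
  then show ?thesis
    using M by (auto simp: MCauchy_def)
qed

text \<open>Both metrics induce \<open>T\<close>, so an \<open>e\<close>-ball is open for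
  \<open>d\<close>. The radius \<delta> depends on \<open>a\<close>, so \<open>d\<close>-Cauchy
  sequences need not be \<open>e\<close>-Cauchy.\<close>

lemma compatible_metric_ball_refine:
  assumes "compatible_metric T d" "compatible_metric T e" "a \<in> topspace T" "\<epsilon> > 0"
  obtains \<delta> where "\<delta> > 0" "\<And>b. b \<in> topspace T \<Longrightarrow> d a b < \<delta> \<Longrightarrow> e a b < \<epsilon>"
proof -
  interpret D: Metric_space "topspace T" d using assms by (simp add: compatible_metric_def)
  interpret E: Metric_space "topspace T" e using assms by (simp add: compatible_metric_def)
  have "openin D.mtopology (E.mball a \<epsilon>)"
    using assms(1,2) E.openin_mball by (metis compatible_metric_def)
  then obtain \<delta> where "\<delta> > 0" "D.mball a \<delta> \<subseteq> E.mball a \<epsilon>"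
    using assms by (auto simp: D.openin_mtopology)
  then show ?thesis
    using that[of \<delta>] assms(3) by (auto simp: subset_iff)
qed

section \<open>Completeness of two-sided invariant metrics\<close>

context topological_group
begin

lemma limitin_mult:
  assumes "limitin T f a F" "limitin T g b F"
  shows "limitin T (\<lambda>i. f i \<otimes> g i) (a \<otimes> b) F"
  using continuous_map_limit[OF continuous_mult, of "\<lambda>i. (f i, g i)" "(a, b)" F] assms
  by (auto simp: limitin_pairwise o_def)

lemma limitin_inv:
  assumes "limitin T f a F"
  shows "limitin T (\<lambda>i. inv (f i)) (inv a) F"
  using continuous_map_limit[OF continuous_inv assms] by (simp add: o_def)

text \<open>Let \<open>\<rho>\<close> be a complete compatible metric and \<open>z\<close> a \<open>d\<close>-Cauchy sequence.  We choose \<open>g k\<close> and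
  indices \<open>m k\<close> such that both \<open>g k\<close> and \<open>z (m k) (g k)\<close> are \<open>\<rho>\<close>-Cauchy; then \<open>z (m k)\<close> converges.
  Moving from \<open>(g, z n g)\<close> to \<open>(g', z n' g')\<close> goes through \<open>g' = (z m)\<inverse> (z n g)\<close>: first only the
  left component moves, by \<open>d (z m) (z n)\<close>, then only the right one, by \<open>d (z m) (z n')\<close>.  So \<open>m\<close> can
  be chosen after the \<open>\<rho>\<close>-modulus at \<open>z n g\<close> is known, and \<open>n'\<close> after the one at \<open>g'\<close>.\<close>

lemma two_sided_invariant_metric_complete:
  assumes "completely_metrizable_space T"
    and d: "compatible_metric T d" and inv: "two_sided_invariant G d"
  shows "Metric_space.mcomplete (topspace T) d"
proof -
  interpret D: Metric_space "topspace T" d using d by (simp add: compatible_metric_def)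
  have TD: "D.mtopology = T" using d by (simp add: compatible_metric_def)
  obtain \<rho> where \<rho>: "compatible_complete_metric T \<rho>"
    using assms(1) Metric_space.topspace_mtopology
    unfolding completely_metrizable_space_def compatible_complete_metric_def compatible_metric_def
    by metis
  then have \<rho>c: "compatible_metric T \<rho>" by (simp add: compatible_complete_metric_def)
  interpret R: Metric_space "topspace T" \<rho> using \<rho>c by (simp add: compatible_metric_def)
  have TR: "R.mtopology = T" using \<rho>c by (simp add: compatible_metric_def)
  have complete: "\<exists>l. limitin T s l sequentially" if "R.MCauchy s" for s
    using \<rho> that TR by (auto simp: compatible_complete_metric_def R.mcomplete_def)
  have dl: "d (a \<otimes> b) (a \<otimes> c) = d b c" and dr: "d (b \<otimes> a) (c \<otimes> a) = d b c"
    if "a \<in> carrier G" "b \<in> carrier G" "c \<in> carrier G" for a b c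
    using inv that by (auto simp: two_sided_invariant_def)
  have "\<exists>l. limitin T z l sequentially" if z: "D.MCauchy z" for z
  proof -
    have zG: "z n \<in> carrier G" for n
      using z[unfolded D.MCauchy_def] topspace_eq range_subsetD by metis
    have zC: "\<exists>N>n. \<forall>i\<ge>N. \<forall>j\<ge>N. d (z i) (z j) < \<epsilon>" if "\<epsilon> > 0" for \<epsilon> n
    proof -
      obtain N where N: "\<And>i j. N \<le> i \<Longrightarrow> N \<le> j \<Longrightarrow> d (z i) (z j) < \<epsilon>"
        using z \<open>\<epsilon> > 0\<close> unfolding D.MCauchy_def by blast
      have "n < max N (Suc n)" by simp
      moreover have "\<forall>i\<ge>max N (Suc n). \<forall>j\<ge>max N (Suc n). d (z i) (z j) < \<epsilon>"
        using N by simp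
      ultimately show ?thesis by blast
    qed
    \<comment> \<open>A state is a pair \<open>(g, n)\<close>. \<open>P\<close> says that
      \<open>n\<close> is late enough for \<open>g\<close>: beyond \<open>n\<close> the sequence
      \<open>z\<close> oscillates by less than a \<open>d\<close>-radius \<open>r\<close> that keeps
      points \<rho>-close to \<open>g\<close>.\<close>
    define P where "P k p \<longleftrightarrow> fst p \<in> carrier G \<and> (\<exists>r>0.
        (\<forall>b\<in>carrier G. d (fst p) b < r \<longrightarrow> \<rho> (fst p) b < (1/2) ^ k) \<and>
        (\<forall>i\<ge>snd p. \<forall>j\<ge>snd p. d (z i) (z j) < r))" for k and p :: "'a \<times> nat"
    define Q where "Q k p q \<longleftrightarrow> snd p < snd q \<and> \<rho> (fst p) (fst q) < (1/2) ^ k \<and>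
        \<rho> (z (snd p) \<otimes> fst p) (z (snd q) \<otimes> fst q) < (1/2) ^ k" for k and p q :: "'a \<times> nat"
    have ex: "\<exists>n>m. P k (g, n)" if g: "g \<in> carrier G" for g k m
    proof -
      obtain r where r: "r > 0" "\<And>b. b \<in> topspace T \<Longrightarrow> d g b < r \<Longrightarrow> \<rho> g b < (1/2) ^ k"
        by (rule compatible_metric_ball_refine[OF d \<rho>c, of g "(1/2) ^ k"])
          (use g in \<open>simp_all add: topspace_eq\<close>)
      obtain n where n: "n > m" "\<forall>i\<ge>n. \<forall>j\<ge>n. d (z i) (z j) < r"
        using zC[OF r(1), of m] by blast
      have "\<forall>b\<in>carrier G. d g b < r \<longrightarrow> \<rho> g b < (1/2) ^ k"
        using r(2) by (simp add: topspace_eq)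
      then have "P k (g, n)"
        unfolding P_def fst_conv snd_conv using g r(1) n(2) by blast
      then show ?thesis using n(1) by blast
    qed
    have "\<exists>f. \<forall>k. P k (f k) \<and> Q k (f k) (f (Suc k))"
    proof (rule dependent_nat_choice)
      show "\<exists>p. P 0 p" using ex[of \<one> 0] by blast
    next
      fix p k assume P: "P k p"
      obtain g n where p: "p = (g, n)" by fastforce
      have g: "g \<in> carrier G" using P by (simp add: P_def p)
      obtain r where r: "\<And>b. b \<in> carrier G \<Longrightarrow> d g b < r \<Longrightarrow> \<rho> g b < (1/2) ^ k"
          "\<And>i j. i \<ge> n \<Longrightarrow> j \<ge> n \<Longrightarrow> d (z i) (z j) < r"
        using P by (auto simp: P_def p)
      define w where "w = z n \<otimes> g"
      have w: "w \<in> carrier G" using g zG by (simp add: w_def)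
      obtain t where t: "t > 0" "\<And>b. b \<in> topspace T \<Longrightarrow> d w b < t \<Longrightarrow> \<rho> w b < (1/2) ^ k"
        by (rule compatible_metric_ball_refine[OF d \<rho>c, of w "(1/2) ^ k"])
          (use w in \<open>simp_all add: topspace_eq\<close>)
      obtain m where m: "m > n" "\<And>i j. i \<ge> m \<Longrightarrow> j \<ge> m \<Longrightarrow> d (z i) (z j) < t"
        using zC[OF t(1), of n] by blast
      define g' where "g' = inv (z m) \<otimes> w"
      have g': "g' \<in> carrier G" using w zG by (simp add: g'_def)
      have mg': "z m \<otimes> g' = w" using w zG by (simp add: g'_def m_assoc[symmetric])
      obtain n' where n': "n' > m" "P (Suc k) (g', n')" using ex[OF g'] by blast
      \<comment> \<open>Left invariance inserts \<open>z m\<close>, then right invariance cancels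
        \<open>g\<close>, since \<open>z m \<otimes> g'\<close> and \<open>z n \<otimes> g\<close>
        are both \<open>w\<close>.\<close>
      have "d g g' = d (z m \<otimes> g) (z m \<otimes> g')" using dl g g' zG by simp
      also have "\<dots> = d (z m) (z n)" unfolding mg' w_def using dr g zG by simp
      also have "\<dots> < r" using r(2) m(1) by simp
      finally have 1: "\<rho> g g' < (1/2) ^ k" using r(1) g' by simp
      \<comment> \<open>Now \<open>g'\<close> is fixed, and right invariance cancels it.\<close>
      have "d w (z n' \<otimes> g') = d (z m) (z n')" unfolding mg'[symmetric] using dr g' zG by simp
      also have "\<dots> < t" using m(2) n'(1) by simp
      finally have 2: "\<rho> w (z n' \<otimes> g') < (1/2) ^ k" using t(2) g' zG by (simp add: topspace_eq)
      have "Q k p (g', n')" using 1 2 m(1) n'(1) by (simp add: Q_def p w_def)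
      then show "\<exists>q. P (Suc k) q \<and> Q k p q" using n'(2) by blast
    qed
    then obtain f where f: "\<And>k. P k (f k)" "\<And>k. Q k (f k) (f (Suc k))" by blast
    define g where "g k = fst (f k)" for k
    define m where "m k = snd (f k)" for k
    have gG: "g k \<in> carrier G" for k using f(1)[of k] by (simp add: P_def g_def)
    have m: "strict_mono m" using f(2) by (simp add: Q_def m_def strict_mono_Suc_iff)
    have "R.MCauchy g"
      using f(2) gG by (intro R.MCauchy_of_geometric_steps) (auto simp: Q_def g_def topspace_eq)
    then obtain a where a: "limitin T g a sequentially" using complete by blast
    have "R.MCauchy (\<lambda>k. z (m k) \<otimes> g k)"
      using f(2) gG zG
      by (intro R.MCauchy_of_geometric_steps) (auto simp: Q_def g_def m_def topspace_eq)
    then obtain b where b: "limitin T (\<lambda>k. z (m k) \<otimes> g k) b sequentially" using complete by blast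
    \<comment> \<open>Cancelling \<open>g k\<close> recovers a convergent subsequence of the
      \<open>d\<close>-Cauchy sequence \<open>z\<close>, which forces \<open>z\<close> to
      converge.\<close>
    have "limitin T (\<lambda>k. z (m k) \<otimes> g k \<otimes> inv (g k)) (b \<otimes> inv a) sequentially"
      by (intro limitin_mult limitin_inv a b)
    moreover have "z (m k) \<otimes> g k \<otimes> inv (g k) = (z \<circ> m) k" for k
      using gG zG by (simp add: m_assoc)
    ultimately have "limitin T (z \<circ> m) (b \<otimes> inv a) sequentially"
      by (simp add: comp_def)
    then show ?thesis
      using D.MCauchy_convergent_subsequence[OF z m] TD by auto
  qed
  then show ?thesis
    by (simp add: D.mcomplete_def TD)
qed

section \<open>The relation for the action of c(G) under an invariant metric\<close>

lemma conv_seq_action_apply: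
  assumes "\<And>n. x n \<in> carrier G"
  shows "conv_seq_action G \<gamma> x = (\<lambda>n. \<gamma> n \<otimes> x n)"
  using assms by (simp add: conv_seq_action_def PiE_UNIV_domain)

text \<open>Right invariance makes each translate by \<open>V\<close> move coordinate
  \<open>n\<close> of \<open>w\<close> by at most \<epsilon>. This weak bound is a closed condition
  on \<open>u\<close>, as evaluation at \<open>n\<close> is continuous, so it passes to the
  closure.\<close>

lemma closure_of_ball_translate_le:
  assumes d: "compatible_metric T d" and inv: "two_sided_invariant G d"
    and w: "\<And>n. w n \<in> carrier G"
    and V: "\<And>v n. v \<in> V \<Longrightarrow> v n \<in> carrier G \<and> d \<one> (v n) \<le> \<epsilon>"
    and u: "u \<in> seq_topology T closure_of ((\<lambda>v. conv_seq_action G v w) ` V)"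
  shows "d (w n) (u n) \<le> \<epsilon>"
proof -
  interpret D: Metric_space "topspace T" d using d by (simp add: compatible_metric_def)
  have TD: "D.mtopology = T" using d by (simp add: compatible_metric_def)
  have "closedin (seq_topology T) {u \<in> topspace (seq_topology T). u n \<in> D.mcball (w n) \<epsilon>}"
    using D.closedin_mcball[of "w n" \<epsilon>] TD
    by (intro closedin_continuous_map_preimage[OF continuous_map_product_projection]) auto
  moreover have "(\<lambda>v. conv_seq_action G v w) ` V \<subseteq>
      {u \<in> topspace (seq_topology T). u n \<in> D.mcball (w n) \<epsilon>}"
  proof (rule image_subsetI)
    fix v assume v: "v \<in> V"
    have "d (w n) (v n \<otimes> w n) = d (\<one> \<otimes> w n) (v n \<otimes> w n)" using w by simp
    also have "\<dots> = d \<one> (v n)"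
      using inv V[OF v, of n] w[of n] unfolding two_sided_invariant_def by blast
    finally have "d (w n) (v n \<otimes> w n) \<le> \<epsilon>" using V[OF v] by simp
    moreover have "w n \<in> topspace T" "\<And>n. v n \<otimes> w n \<in> topspace T"
      using V[OF v] w unfolding topspace_eq by blast+
    ultimately show "conv_seq_action G v w \<in>
        {u \<in> topspace (seq_topology T). u n \<in> D.mcball (w n) \<epsilon>}"
      unfolding conv_seq_action_apply[OF w] by (simp add: PiE_UNIV_domain)
  qed
  ultimately have "u n \<in> D.mcball (w n) \<epsilon>"
    using closure_of_minimal u by blast
  then show ?thesis by simp
qed

lemma squig_related_imp_uniformly_close:
  assumes d: "compatible_metric T d" and inv: "two_sided_invariant G d"
    and x: "\<And>n. x n \<in> carrier G" and y: "\<And>n. y n \<in> carrier G"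
    and rel: "squig_related (conv_seq_group G T) (conv_seq_topology G T d) (seq_topology T)
           (conv_seq_action G) x y"
    and \<epsilon>: "\<epsilon> > 0"
  obtains c where "c \<in> carrier (conv_seq_group G T)" "\<And>n. d (c n) (y n \<otimes> inv (x n)) \<le> \<epsilon>"
proof -
  let ?C = "conv_seq_group G T"
  let ?\<phi> = "conv_seq_action G"
  interpret A: group_action ?C "carrier (seq_group G)" ?\<phi> by (rule group_action_conv_seq)
  interpret C: group ?C by (rule group_conv_seq)
  interpret M: Metric_space "carrier ?C" "sup_dist T d" by (rule Metric_space_sup_dist[OF d])
  have one: "\<one>\<^bsub>?C\<^esub> = (\<lambda>_. \<one>)" by (simp add: conv_seq_group_def restrict_UNIV)
  have xE: "x \<in> carrier (seq_group G)" using x by (simp add: PiE_UNIV_domain)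
  have "openin (conv_seq_topology G T d) (M.mball \<one>\<^bsub>?C\<^esub> \<epsilon>)"
    unfolding conv_seq_topology_def by (rule M.openin_mball)
  moreover have "\<one>\<^bsub>?C\<^esub> \<in> M.mball \<one>\<^bsub>?C\<^esub> \<epsilon>" using \<epsilon> C.one_closed by simp
  moreover have "openin (seq_topology T) (topspace (seq_topology T))" by (rule openin_topspace)
  moreover have "topspace (seq_topology T) \<inter> (orbit ?C ?\<phi> x \<union> orbit ?C ?\<phi> y) \<noteq> {}"
    using A.orbit_refl[OF xE] xE by (auto simp: topspace_eq)
  ultimately obtain g h where g: "g \<in> carrier ?C" and h: "h \<in> carrier ?C"
    and cl: "?\<phi> h y \<in> seq_topology T closure_of ((\<lambda>v. ?\<phi> v (?\<phi> g x)) ` M.mball \<one>\<^bsub>?C\<^esub> \<epsilon>)"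
    using rel unfolding squig_related_def by blast
  have gG: "g n \<in> carrier G" and hG: "h n \<in> carrier G" for n
    using g h by (auto simp: conv_seq_carrier)
  have ball: "v n \<in> carrier G \<and> d \<one> (v n) \<le> \<epsilon>" if v: "v \<in> M.mball \<one>\<^bsub>?C\<^esub> \<epsilon>" for v n
  proof -
    have vC: "v \<in> carrier ?C" and s: "sup_dist T d \<one>\<^bsub>?C\<^esub> v < \<epsilon>" using v by auto
    \<comment> \<open>The supremum distance dominates the distance in each coordinate.\<close>
    have "d (\<one>\<^bsub>?C\<^esub> n) (v n) \<le> sup_dist T d \<one>\<^bsub>?C\<^esub> v"
      unfolding sup_dist_conv_seq(1)[OF d C.one_closed vC]
      by (rule cSUP_upper[OF UNIV_I sup_dist_conv_seq(2)[OF d C.one_closed vC]])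
    then show ?thesis using vC s by (simp add: one conv_seq_carrier)
  qed
  have close: "d (g n \<otimes> x n) (h n \<otimes> y n) \<le> \<epsilon>" for n
  proof -
    have w: "?\<phi> g x n \<in> carrier G" for n using x gG by (simp add: conv_seq_action_apply)
    have "d (?\<phi> g x n) (?\<phi> h y n) \<le> \<epsilon>"
    proof (rule closure_of_ball_translate_le[where w = "?\<phi> g x" and u = "?\<phi> h y", OF d inv])
      show "?\<phi> h y \<in> seq_topology T closure_of ((\<lambda>v. ?\<phi> v (?\<phi> g x)) ` M.mball \<one>\<^bsub>?C\<^esub> \<epsilon>)"
        by (rule cl)
    qed (use w ball in blast)+
    then show ?thesis using x y by (simp add: conv_seq_action_apply)
  qed
  show ?thesis
  proof
    obtain a b where "limitin T g a sequentially" "limitin T h b sequentially"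
      using g h by (auto simp: conv_seq_carrier)
    then have "limitin T (\<lambda>n. inv (h n) \<otimes> g n) (inv b \<otimes> a) sequentially"
      by (intro limitin_mult limitin_inv)
    then show "(\<lambda>n. inv (h n) \<otimes> g n) \<in> carrier ?C"
      using gG hG by (auto simp: conv_seq_carrier)
  next
    fix n
    have dl: "d (a \<otimes> b) (a \<otimes> c) = d b c" and dr: "d (b \<otimes> a) (c \<otimes> a) = d b c"
      if "a \<in> carrier G" "b \<in> carrier G" "c \<in> carrier G" for a b c
      using inv that by (auto simp: two_sided_invariant_def)
    \<comment> \<open>Multiplying by \<open>h n\<close> on the left and by \<open>x n\<close> on the
      right preserves \<open>d\<close> and reduces the claim to \<open>close\<close>.\<close>
    have "d (inv (h n) \<otimes> g n) (y n \<otimes> inv (x n))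
        = d (h n \<otimes> (inv (h n) \<otimes> g n) \<otimes> x n) (h n \<otimes> (y n \<otimes> inv (x n)) \<otimes> x n)"
      using dl dr gG hG x y by simp
    also have "h n \<otimes> (inv (h n) \<otimes> g n) = g n"
      using gG hG by (simp add: m_assoc[symmetric])
    also have "h n \<otimes> (y n \<otimes> inv (x n)) \<otimes> x n = h n \<otimes> y n"
      using hG x y by (simp add: m_assoc)
    finally show "d (inv (h n) \<otimes> g n) (y n \<otimes> inv (x n)) \<le> \<epsilon>"
      using close by simp
  qed
qed

end

section \<open>From uniform approximation to equality of orbits\<close>

text \<open>The three-epsilon argument through \<open>c n\<close> and \<open>c n'\<close>; the
  approximant may change with \<epsilon>.\<close>

lemma (in Metric_space) MCauchy_of_uniform_approx:
  assumes M: "\<And>n. s n \<in> M"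
    and approx: "\<And>\<epsilon>. \<epsilon> > 0 \<Longrightarrow> \<exists>c. MCauchy c \<and> (\<forall>n. d (c n) (s n) \<le> \<epsilon>)"
  shows "MCauchy s"
proof -
  have "\<exists>N. \<forall>n n'. N \<le> n \<longrightarrow> N \<le> n' \<longrightarrow> d (s n) (s n') < \<epsilon>" if "\<epsilon> > 0" for \<epsilon>
  proof -
    have \<epsilon>3: "\<epsilon> / 3 > 0" using that by simp
    obtain c where c: "MCauchy c" "\<And>n. d (c n) (s n) \<le> \<epsilon> / 3"
      using approx[OF \<epsilon>3] by blast
    obtain N where N: "\<And>n n'. N \<le> n \<Longrightarrow> N \<le> n' \<Longrightarrow> d (c n) (c n') < \<epsilon> / 3"
      using c(1) \<epsilon>3 unfolding MCauchy_def by blast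
    have cM: "c n \<in> M" for n using c(1) by (auto simp: MCauchy_def)
    have "d (s n) (s n') < \<epsilon>" if "N \<le> n" "N \<le> n'" for n n'
    proof -
      have "d (s n) (s n') \<le> d (c n) (s n) + d (c n) (s n')"
        using triangle'' M cM by blast
      moreover have "d (c n) (s n') \<le> d (c n) (c n') + d (c n') (s n')"
        using triangle M cM by blast
      ultimately show ?thesis
        using c(2)[of n] c(2)[of n'] N[OF that] by linarith
    qed
    then show ?thesis by blast
  qed
  then show ?thesis using M by (auto simp: MCauchy_def)
qed

theorem theorem5p4:
  fixes G :: "('a, 'b) monoid_scheme" and T :: "'a topology"
  assumes "polish_group G T"
    and "TSI G T"
  shows "\<not> unbalanced G T"
proof
  assume "unbalanced G T"
  interpret polish_group G T by fact
  let ?C = "conv_seq_group G T"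
  let ?\<phi> = "conv_seq_action G"
  obtain d where d: "compatible_metric T d" and inv: "two_sided_invariant G d"
    using assms(2) by (auto simp: TSI_def)
  interpret D: Metric_space "topspace T" d using d by (simp add: compatible_metric_def)
  have TD: "D.mtopology = T" using d by (simp add: compatible_metric_def)
  obtain e x y where e: "compatible_complete_metric T e"
    and xE: "x \<in> carrier (seq_group G)" and yE: "y \<in> carrier (seq_group G)"
    and rel: "squig_related ?C (conv_seq_topology G T e) (seq_topology T) ?\<phi> x y"
    and ne: "orbit ?C ?\<phi> x \<noteq> orbit ?C ?\<phi> y"
    using \<open>unbalanced G T\<close> unfolding unbalanced_def by blast
  have xG: "x n \<in> carrier G" and yG: "y n \<in> carrier G" for n
    using xE yE by (auto simp: PiE_UNIV_domain)
  \<comment> \<open>The metric \<open>e\<close> comes from \<open>unbalanced\<close> and may differ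
    from the invariant \<open>d\<close>. Both give c(G) the same topology, so \<open>d\<close>-balls
    can serve as neighbourhoods of the identity.\<close>
  have "conv_seq_topology G T e = conv_seq_topology G T d"
    using e d by (intro conv_seq_topology_unique) (simp_all add: compatible_complete_metric_def)
  with rel have rel: "squig_related ?C (conv_seq_topology G T d) (seq_topology T) ?\<phi> x y" by simp
  define s where "s n = y n \<otimes>\<^bsub>G\<^esub> inv\<^bsub>G\<^esub> (x n)" for n
  have sG: "s n \<in> carrier G" for n using xG yG by (simp add: s_def)
  have "D.MCauchy s"
  proof (rule D.MCauchy_of_uniform_approx)
    show "s n \<in> topspace T" for n using sG by (simp add: topspace_eq)
    fix \<epsilon> :: real assume "\<epsilon> > 0"
    then obtain c where c: "c \<in> carrier ?C" "\<And>n. d (c n) (s n) \<le> \<epsilon>"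
      using squig_related_imp_uniformly_close[OF d inv xG yG rel] unfolding s_def by blast
    have "D.MCauchy c"
      using c(1) TD D.convergent_imp_MCauchy by (auto simp: conv_seq_carrier topspace_eq)
    then show "\<exists>c. D.MCauchy c \<and> (\<forall>n. d (c n) (s n) \<le> \<epsilon>)" using c(2) by blast
  qed
  moreover have "D.mcomplete"
    using two_sided_invariant_metric_complete[OF _ d inv] polish by (simp add: polish_topology_def)
  ultimately have "s \<in> carrier ?C"
    using sG TD by (auto simp: D.mcomplete_def conv_seq_carrier)
  moreover have "?\<phi> s x = y"
    using xG yG by (simp add: conv_seq_action_apply s_def m_assoc)
  ultimately have "y \<in> orbit ?C ?\<phi> x"
    by (auto simp: orbit_def)
  interpret A: group_action ?C "carrier (seq_group G)" ?\<phi> by (rule group_action_conv_seq)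
  \<comment> \<open>Orbits are equal or disjoint, and both contain \<open>y\<close>.\<close>
  have "orbit ?C ?\<phi> x = orbit ?C ?\<phi> y"
    using A.disjoint_union[of "orbit ?C ?\<phi> x" "orbit ?C ?\<phi> y"] A.orbit_refl[OF yE]
      \<open>y \<in> orbit ?C ?\<phi> x\<close> xE yE unfolding orbits_def by blast
  with ne show False by contradiction
qed

end
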